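(* Let $G$ be a finite graph with at least one vertex, and let $$M = \max\left\{ \frac{\frac{1}{\sqrt{3}}\,|\operatorname{Im} z| + |\operatorname{Re} z|}{|z|^2} \;:\; z\in\mathbb{C} \text{ is a root of } i(G,x)\right\}.$$ If $k$ is a positive integer with $k > M$, then the sequence of coefficients of $i(G^{k\ast},x)$ is strictly log concave.
   Context: Graphs are finite, simple and undirected. A set of vertices is independent if it induces no edges. The independence polynomial of a graph $G$ is $i(G,x)=\sum_{j=0}^{\alpha(G)} i_j x^j$, where $i_j$ is the number of independent sets of size $j$ in $G$ and $\alpha(G)$ is the maximum size of an independent set (its constant term is $i_0=1$, so $0$ is never a root). The leafy extension $G^\ast$ of a graph $G$ is formed from $G$ by adding, for each vertex $v$ of $G$, one new vertex $v^\ast$ that is adjacent to $v$ and to no other vertex. The iterated leafy extensions are defined by $G^{1\ast}=G^\ast$ and $G^{k\ast}=(G^{(k-1)\ast})^\ast$ for $k\ge 2$. A sequence $\langle a_0,a_1,\ldots,a_d\rangle$ is strictly log concave if $a_j^2 > a_{j-1}a_{j+1}$ for all $0<j<d$; here it is applied to the coefficient sequence of a polynomial of degree $d$. *)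

theory Defs
  imports
    Complex_Main
    "HOL-Computational_Algebra.Polynomial"
    "Graph_Theory.Pair_Digraph"
begin

text \<open>
  A finite simple undirected graph is a \<open>pair_graph\<close>: a finite loop-free digraph whose arc set is
  a symmetric relation on the vertices.
\<close>

definition independent_sets :: "'a pair_pre_digraph \<Rightarrow> 'a set set" where
  "independent_sets G = {S. S \<subseteq> pverts G \<and> (\<forall>u\<in>S. \<forall>v\<in>S. (u, v) \<notin> parcs G)}"

definition independence_number :: "'a pair_pre_digraph \<Rightarrow> nat" where
  "independence_number G = Max (card ` independent_sets G)"

definition independence_poly :: "'a pair_pre_digraph \<Rightarrow> nat poly" where
  "independence_poly G =
     (\<Sum>j\<le>independence_number G. monom (card {S \<in> independent_sets G. card S = j}) j)"

text \<open>
  Vertices carry a list of tags so that the leafy extension can be iterated within one type: in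
  the extension, \<open>(v, False # bs)\<close> is the copy of the old vertex \<open>(v, bs)\<close>, and
  \<open>(v, True # bs)\<close> is the new leaf attached to it.
\<close>

definition old_vertex :: "'a \<times> bool list \<Rightarrow> 'a \<times> bool list" where
  "old_vertex x = (fst x, False # snd x)"

definition new_leaf :: "'a \<times> bool list \<Rightarrow> 'a \<times> bool list" where
  "new_leaf x = (fst x, True # snd x)"

definition leafy_extension ::
    "('a \<times> bool list) pair_pre_digraph \<Rightarrow> ('a \<times> bool list) pair_pre_digraph" where
  "leafy_extension G =
     \<lparr> pverts = old_vertex ` pverts G \<union> new_leaf ` pverts G,
       parcs = (\<lambda>(u, v). (old_vertex u, old_vertex v)) ` parcs G
         \<union> (\<lambda>v. (old_vertex v, new_leaf v)) ` pverts G
         \<union> (\<lambda>v. (new_leaf v, old_vertex v)) ` pverts G \<rparr>"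

definition untagged :: "'a pair_pre_digraph \<Rightarrow> ('a \<times> bool list) pair_pre_digraph" where
  "untagged G =
     \<lparr> pverts = (\<lambda>v. (v, [])) ` pverts G,
       parcs = (\<lambda>(u, v). ((u, []), (v, []))) ` parcs G \<rparr>"

definition iterated_leafy_extension ::
    "nat \<Rightarrow> 'a pair_pre_digraph \<Rightarrow> ('a \<times> bool list) pair_pre_digraph" where
  "iterated_leafy_extension k G = (leafy_extension ^^ k) (untagged G)"

definition strictly_log_concave :: "'a::linordered_semidom poly \<Rightarrow> bool" where
  "strictly_log_concave p \<longleftrightarrow>
     (\<forall>j. 0 < j \<and> j < degree p \<longrightarrow> coeff p j ^ 2 > coeff p (j - 1) * coeff p (j + 1))"

lemma old_vertex_eq_iff [simp]: "old_vertex u = old_vertex v \<longleftrightarrow> u = v"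
  by (auto simp: old_vertex_def prod_eq_iff)

lemma new_leaf_eq_iff [simp]: "new_leaf u = new_leaf v \<longleftrightarrow> u = v"
  by (auto simp: new_leaf_def prod_eq_iff)

lemma old_vertex_neq_new_leaf [simp]:
  "old_vertex u \<noteq> new_leaf v" "new_leaf v \<noteq> old_vertex u"
  by (auto simp: old_vertex_def new_leaf_def)

lemma pair_graphI:
  assumes "finite (pverts G)" "parcs G \<subseteq> pverts G \<times> pverts G"
    and "sym (parcs G)" "irrefl (parcs G)"
  shows "pair_graph G"
proof unfold_locales
  show "finite (parcs G)"
    using assms by (auto intro: finite_subset)
  show "symmetric (with_proj G)"
    using assms by (simp add: symmetric_def)
qed (use assms in \<open>auto simp: irrefl_def\<close>)

lemma pair_graphD:
  assumes "pair_graph G"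
  shows "finite (pverts G)" "parcs G \<subseteq> pverts G \<times> pverts G"
    "sym (parcs G)" "irrefl (parcs G)"
proof -
  interpret pair_graph G by fact
  show "finite (pverts G)" by simp
  show "parcs G \<subseteq> pverts G \<times> pverts G" by (auto dest: in_arcsD1 in_arcsD2)
  show "sym (parcs G)" using pair_sym_arcs by (simp add: symmetric_def)
  show "irrefl (parcs G)" using pair_no_loops by (force simp: irrefl_def)
qed

lemma pair_graph_leafy_extension:
  assumes "pair_graph G"
  shows "pair_graph (leafy_extension G)"
proof (rule pair_graphI)
  note G = pair_graphD[OF assms]
  show "finite (pverts (leafy_extension G))"
    using G(1) by (simp add: leafy_extension_def)
  show "parcs (leafy_extension G) \<subseteq> pverts (leafy_extension G) \<times> pverts (leafy_extension G)"
    using G(2) by (auto simp: leafy_extension_def simp del: split_paired_All split_paired_Ex)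
  show "sym (parcs (leafy_extension G))"
  proof (rule symI)
    fix x y assume "(x, y) \<in> parcs (leafy_extension G)"
    then consider
        u v where "(u, v) \<in> parcs G" "x = old_vertex u" "y = old_vertex v"
      | v where "v \<in> pverts G" "x = old_vertex v" "y = new_leaf v"
      | v where "v \<in> pverts G" "x = new_leaf v" "y = old_vertex v"
      unfolding leafy_extension_def pair_pre_digraph.simps
      by (elim UnE imageE) (auto simp del: split_paired_All split_paired_Ex)
    then show "(y, x) \<in> parcs (leafy_extension G)"
    proof cases
      case 1
      with G(3) have "(v, u) \<in> parcs G" by (blast dest: symD)
      then have "(\<lambda>(u, v). (old_vertex u, old_vertex v)) (v, u) \<in> parcs (leafy_extension G)"
        unfolding leafy_extension_def pair_pre_digraph.simps by blast
      with 1 show ?thesis by simp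
    qed (unfold leafy_extension_def pair_pre_digraph.simps, blast+)
  qed
  show "irrefl (parcs (leafy_extension G))"
    using G(4) unfolding irrefl_def leafy_extension_def pair_pre_digraph.simps
    by (auto simp del: split_paired_All split_paired_Ex)
qed

lemma pair_graph_untagged:
  assumes "pair_graph G"
  shows "pair_graph (untagged G)"
proof (rule pair_graphI)
  note G = pair_graphD[OF assms]
  show "finite (pverts (untagged G))"
    using G(1) by (simp add: untagged_def)
  show "parcs (untagged G) \<subseteq> pverts (untagged G) \<times> pverts (untagged G)"
    using G(2) by (auto simp: untagged_def)
  show "sym (parcs (untagged G))"
    using G(3) unfolding untagged_def by (auto intro!: symI dest: symD)
  show "irrefl (parcs (untagged G))"
    using G(4) by (auto simp: untagged_def irrefl_def)
qed

lemma pair_graph_iterated_leafy_extension: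
  assumes "pair_graph G"
  shows "pair_graph (iterated_leafy_extension k G)"
  unfolding iterated_leafy_extension_def
  by (induction k) (simp_all add: assms pair_graph_untagged pair_graph_leafy_extension)

end

theory Submission
  imports Defs "HOL-Computational_Algebra.Fundamental_Theorem_Algebra"
begin

text \<open>
  Since $i(G^*, x) = (1 + x)^{|V|}\, i(G, x / (1 + x))$, each leafy extension moves $1/x$ by $-1$ at
  every root $x$, apart from the new root $-1$. So every root $x$ of $i(G^{k*}, x)$ is either a
  negative real or satisfies $1/x = 1/z - k$ for some root $z$ of $i(G, x)$, and $k > M$ forces
  such an $x$ to lie in the sector $|\mathrm{Im}\, x| < -\sqrt 3\, \mathrm{Re}\, x$.
  A real polynomial with positive constant term and all its roots in this sector is, up to a
  constant, a product of factors $1 + b x + c x^2$ with $b > 0$ and $0 \le c < b^2$, and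
  multiplication by such a factor preserves strict log concavity of positive sequences.
\<close>

section \<open>Log concave sequences under multiplication by a quadratic factor\<close>

text \<open>Positivity on the support makes the ratios \<open>f (i + 1) / f i\<close> weakly
  decreasing there, so moving two indices apart cannot increase the product. The induction widens
  the gap on the right; division is avoided by multiplying through by \<open>f b\<close> and
  cancelling it at the end.\<close>

lemma log_concave_spread:
  fixes f :: "int \<Rightarrow> real"
  assumes pos: "\<And>i. 0 \<le> i \<Longrightarrow> i \<le> d \<Longrightarrow> 0 < f i"
    and zero: "\<And>i. i < 0 \<or> d < i \<Longrightarrow> f i = 0"
    and lc: "\<And>i. f (i - 1) * f (i + 1) \<le> (f i)\<^sup>2"
    and "a \<le> b"
  shows "f (a - 1) * f (b + 1) \<le> f a * f b"
  using \<open>a \<le> b\<close>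
proof (induction b rule: int_ge_induct)
  case base
  show ?case using lc[of a] by (simp add: power2_eq_square)
next
  case (step b)
  have nonneg: "0 \<le> f i" for i
    using pos[of i] zero[of i] by (cases "0 \<le> i \<and> i \<le> d") auto
  show ?case
  proof (cases "0 \<le> b \<and> b \<le> d")
    case False
    \<comment> \<open>As \<open>a \<le> b\<close>, an index \<open>b\<close> outside the support
      forces one of the two outer indices outside it.\<close>
    with step.hyps have "a - 1 < 0 \<or> d < b + 1 + 1" by auto
    then have "f (a - 1) * f (b + 1 + 1) = 0" using zero by auto
    then show ?thesis using nonneg by (metis mult_nonneg_nonneg)
  next
    case True
    then have fb: "0 < f b" using pos by auto
    have "f b * (f (a - 1) * f (b + 1 + 1)) = f (a - 1) * (f b * f (b + 1 + 1))" by simp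
    also have "\<dots> \<le> f (a - 1) * (f (b + 1) * f (b + 1))"
      using lc[of "b + 1"] nonneg by (intro mult_left_mono) (auto simp: power2_eq_square)
    also have "\<dots> = (f (a - 1) * f (b + 1)) * f (b + 1)" by simp
    also have "\<dots> \<le> (f a * f b) * f (b + 1)"
      using step.IH nonneg by (intro mult_right_mono) auto
    finally have "f b * (f (a - 1) * f (b + 1 + 1)) \<le> f b * (f a * f (b + 1))"
      by (simp add: mult_ac)
    with fb show ?thesis by simp
  qed
qed

text \<open>Here \<open>g\<close> is the coefficient sequence of the product with
  \<open>1 + b x + c x^2\<close>, and the defect
  \<open>(g j)\<^sup>2 - g (j - 1) * g (j + 1)\<close> is a nonnegative combination of defects of
  \<open>f\<close>. Indexing by integers with zeros outside the support treats both ends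
  uniformly.\<close>

lemma strict_log_concave_convolution:
  fixes f :: "int \<Rightarrow> real"
  assumes pos: "\<And>i. 0 \<le> i \<Longrightarrow> i \<le> d \<Longrightarrow> 0 < f i"
    and zero: "\<And>i. i < 0 \<or> d < i \<Longrightarrow> f i = 0"
    and slc: "\<And>i. 0 < i \<Longrightarrow> i < d \<Longrightarrow> f (i - 1) * f (i + 1) < (f i)\<^sup>2"
    and "0 < b" "0 \<le> c" "c < b\<^sup>2" "0 \<le> d" "0 \<le> j" "j \<le> d + 1"
  defines "g \<equiv> \<lambda>i. f i + b * f (i - 1) + c * f (i - 2)"
  shows "g (j - 1) * g (j + 1) < (g j)\<^sup>2"
proof -
  \<comment> \<open>At both ends of the support a neighbour is zero while \<open>f i\<close> is
    positive, so strictness extends to them.\<close>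
  have slc': "f (i - 1) * f (i + 1) < (f i)\<^sup>2" if "0 \<le> i" "i \<le> d" for i
    using that slc[of i] pos[of i] zero[of "i - 1"] zero[of "i + 1"]
    by (cases "i = 0 \<or> i = d") auto
  have lc: "f (i - 1) * f (i + 1) \<le> (f i)\<^sup>2" for i
    using slc'[of i] zero[of "i - 1"] zero[of "i + 1"] by (cases "0 \<le> i \<and> i \<le> d") auto
  note spread = log_concave_spread[of d f, OF pos zero lc]
  define D where "D i = (f i)\<^sup>2 - f (i - 1) * f (i + 1)" for i
  have D: "0 \<le> D i" for i using lc[of i] by (simp add: D_def)
  define E1 where "E1 = f (j - 1) * f j - f (j - 2) * f (j + 1)"
  define E2 where "E2 = f (j - 2) * f j - f (j - 3) * f (j + 1)"
  define E3 where "E3 = f (j - 2) * f (j - 1) - f (j - 3) * f j"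
  have E: "0 \<le> E1" "0 \<le> E2" "0 \<le> E3"
    using spread[of "j - 1" j] spread[of "j - 2" j] spread[of "j - 2" "j - 1"]
    by (simp_all add: E1_def E2_def E3_def)
  \<comment> \<open>The terms linear in \<open>c\<close> amount to
    \<open>c * E2 - c * D (j - 1)\<close>; the negative part is absorbed by
    \<open>b\<^sup>2 * D (j - 1)\<close>, which is where \<open>c < b\<^sup>2\<close>
    enters.\<close>
  have expand: "(g j)\<^sup>2 - g (j - 1) * g (j + 1) =
      D j + (b\<^sup>2 - c) * D (j - 1) + c\<^sup>2 * D (j - 2) + b * E1 + c * E2 + b * c * E3"
    by (simp add: g_def D_def E1_def E2_def E3_def power2_eq_square algebra_simps)
  \<comment> \<open>Strictness comes from \<open>D j\<close> inside the support, and from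
    \<open>D d\<close> at the one index \<open>d + 1\<close> beyond it.\<close>
  have "0 < D j + (b\<^sup>2 - c) * D (j - 1)"
  proof (cases "j \<le> d")
    case True
    then have "0 < D j" using slc'[of j] \<open>0 \<le> j\<close> by (simp add: D_def)
    then show ?thesis using D \<open>c < b\<^sup>2\<close> by (intro add_pos_nonneg mult_nonneg_nonneg) auto
  next
    case False
    then have j: "j = d + 1" using \<open>j \<le> d + 1\<close> by simp
    then have "0 < D (j - 1)" using slc'[of d] \<open>0 \<le> d\<close> by (simp add: D_def)
    then show ?thesis using D \<open>c < b\<^sup>2\<close> by (intro add_nonneg_pos mult_pos_pos) auto
  qed
  moreover have "0 \<le> c\<^sup>2 * D (j - 2) + b * E1 + c * E2 + b * c * E3"
    using D E \<open>0 < b\<close> \<open>0 \<le> c\<close> by (intro add_nonneg_nonneg mult_nonneg_nonneg) auto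
  ultimately show ?thesis using expand by linarith
qed

text \<open>Carried along with log concavity to exclude internal zeros. It also excludes the zero
  polynomial, whose degree is \<open>0\<close>.\<close>

definition positive_coeffs :: "real poly \<Rightarrow> bool" where
  "positive_coeffs p \<longleftrightarrow> (\<forall>j\<le>degree p. 0 < coeff p j)"

text \<open>The inductive step for building a polynomial from its factors. Allowing
  \<open>c = 0\<close> covers linear factors as well.\<close>

lemma strictly_log_concave_mult_quadratic:
  fixes p :: "real poly"
  assumes p: "positive_coeffs p" "strictly_log_concave p"
    and bc: "0 < b" "0 \<le> c" "c < b\<^sup>2"
  shows "positive_coeffs ([:1, b, c:] * p)" "strictly_log_concave ([:1, b, c:] * p)"
proof -
  define f where "f i = (if i < 0 then 0 else coeff p (nat i))" for i :: int
  have f_pos: "0 < f i" if "0 \<le> i" "i \<le> int (degree p)" for i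
    using that p(1) by (auto simp: f_def positive_coeffs_def)
  have f_zero: "f i = 0" if "i < 0 \<or> int (degree p) < i" for i
    using that by (auto simp: f_def intro: coeff_eq_0)
  have f_nonneg: "0 \<le> f i" for i
    using f_pos[of i] f_zero[of i] by (cases "0 \<le> i \<and> i \<le> int (degree p)") auto
  have f_slc: "f (i - 1) * f (i + 1) < (f i)\<^sup>2" if "0 < i" "i < int (degree p)" for i
  proof -
    have "nat (i - 1) = nat i - 1" "nat (i + 1) = nat i + 1" using that by auto
    moreover have "coeff p (nat i - 1) * coeff p (nat i + 1) < (coeff p (nat i))\<^sup>2"
      using that p(2) unfolding strictly_log_concave_def by auto
    ultimately show ?thesis using that by (simp add: f_def)
  qed
  define q where "q = [:1, b, c:] * p"
  define g where "g i = f i + b * f (i - 1) + c * f (i - 2)" for i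
  have coeff_q: "coeff q j = g (int j)" for j
  proof -
    have "coeff q j = coeff p j + (case j of 0 \<Rightarrow> 0 | Suc i \<Rightarrow>
        b * coeff p i + (case i of 0 \<Rightarrow> 0 | Suc m \<Rightarrow> c * coeff p m))"
      by (simp add: q_def coeff_pCons split: nat.split)
    then show ?thesis
      by (auto simp: g_def f_def nat_diff_distrib split: nat.splits)
  qed
  have "p \<noteq> 0" using p(1) by (auto simp: positive_coeffs_def)
  then have "degree q = degree [:1, b, c:] + degree p"
    unfolding q_def by (intro degree_mult_eq) auto
  then have deg: "degree q = degree p + (if c = 0 then 1 else 2)"
    using bc by simp
  have "0 < g (int j)" if j: "j \<le> degree q" for j
  proof -
    \<comment> \<open>In each case one of the three nonnegative summands of \<open>g (int j)\<close>
      is positive; the last index is within the degree only if \<open>c \<noteq> 0\<close>.\<close>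
    consider "j \<le> degree p" | "j = degree p + 1" | "c \<noteq> 0" "j = degree p + 2"
      using j deg by (cases "c = 0") force+
    then have "0 < f (int j) \<or> 0 < f (int j - 1) \<or> 0 < c * f (int j - 2)"
      using f_pos[of "int j"] f_pos[of "int j - 1"] f_pos[of "int j - 2"] bc
      by cases (auto simp: zero_less_mult_iff)
    moreover have "0 \<le> f (int j)" "0 \<le> b * f (int j - 1)" "0 \<le> c * f (int j - 2)"
      using f_nonneg bc by auto
    ultimately show ?thesis
      using mult_pos_pos[OF bc(1), of "f (int j - 1)"] by (auto simp: g_def)
  qed
  then show "positive_coeffs ([:1, b, c:] * p)"
    using coeff_q by (simp add: positive_coeffs_def q_def)
  \<comment> \<open>For \<open>c \<noteq> 0\<close> the interior indices run up to
    \<open>degree p + 1\<close>, exactly the range covered by the convolution inequality.\<close>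
  have "coeff q (j - 1) * coeff q (j + 1) < (coeff q j)\<^sup>2" if "0 < j" "j < degree q" for j
  proof -
    have "g (int j - 1) * g (int j + 1) < (g (int j))\<^sup>2"
      unfolding g_def using that bc
      by (intro strict_log_concave_convolution[where d = "int (degree p)"] f_pos f_zero f_slc)
        (auto simp: deg split: if_splits)
    with that show ?thesis by (simp add: coeff_q of_nat_diff add.commute)
  qed
  then show "strictly_log_concave ([:1, b, c:] * p)"
    by (simp add: strictly_log_concave_def q_def)
qed

section \<open>Real polynomials with all complex roots in a sector\<close>

lemma map_poly_of_real_add:
  "map_poly of_real (p + q) = (map_poly of_real p + map_poly of_real q :: 'a :: real_algebra_1 poly)"
  by (rule poly_eqI) (simp add: coeff_map_poly)

lemma map_poly_of_real_mult:
  "map_poly of_real (p * q) =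
    (map_poly of_real p * map_poly of_real q :: 'a :: {real_algebra_1, comm_ring_1} poly)"
  by (rule poly_eqI) (simp add: coeff_map_poly coeff_mult)

text \<open>Strong induction on the degree: a complex root \<open>u\<close> yields a real factor
  with constant term \<open>1\<close>, linear or quadratic according to whether \<open>u\<close> is
  real. The quotient keeps a positive constant term, and its roots are among those of
  \<open>p\<close>.\<close>

lemma strictly_log_concave_if_roots_in_sector:
  fixes p :: "real poly"
  assumes "0 < coeff p 0"
    and "\<And>u :: complex. poly (map_poly of_real p) u = 0 \<Longrightarrow> \<bar>Im u\<bar> < - sqrt 3 * Re u"
  shows "positive_coeffs p \<and> strictly_log_concave p"
  using assms
proof (induction "degree p" arbitrary: p rule: less_induct)
  case less
  show ?case
  proof (cases "degree p = 0")
    case True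
    then show ?thesis using less.prems(1)
      by (simp add: positive_coeffs_def strictly_log_concave_def)
  next
    case False
    then have "\<not> constant (poly (map_poly complex_of_real p))"
      by (simp add: constant_degree degree_map_poly)
    then obtain u where u: "poly (map_poly complex_of_real p) u = 0"
      using fundamental_theorem_of_algebra by blast
    have sector: "\<bar>Im u\<bar> < - sqrt 3 * Re u" using less.prems(2) u by blast
    then have Re: "Re u < 0" using abs_ge_zero[of "Im u"]
      by (smt (verit) mult_minus_left mult_nonneg_nonneg real_sqrt_ge_zero)
    have "\<bar>Im u\<bar>\<^sup>2 < (- sqrt 3 * Re u)\<^sup>2"
      using sector by (intro power_strict_mono) auto
    then have Im_sq: "(Im u)\<^sup>2 < 3 * (Re u)\<^sup>2" by (simp add: power_mult_distrib)
    define N where "N = (cmod u)\<^sup>2"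
    have N: "N = (Re u)\<^sup>2 + (Im u)\<^sup>2" "0 < N" using Re
      by (auto simp: N_def cmod_power2 sum_power2_gt_zero_iff)
    \<comment> \<open>These are the coefficients of \<open>1 - x / u\<close> for real
      \<open>u\<close>, and otherwise of \<open>(1 - x / u) * (1 - x / cnj u)\<close>.\<close>
    define b where "b = (if Im u = 0 then - 1 / Re u else - 2 * Re u / N)"
    define c where "c = (if Im u = 0 then 0 else 1 / N)"
    \<comment> \<open>The squared sector condition says \<open>N < 4 * (Re u)\<^sup>2\<close>;
      divided by \<open>N\<^sup>2\<close> it becomes \<open>c < b\<^sup>2\<close> for a non-real
      root.\<close>
    have "1 / N = N / N\<^sup>2" using N(2) by (simp add: power2_eq_square)
    also have "\<dots> < 4 * (Re u)\<^sup>2 / N\<^sup>2"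
      using N Im_sq by (intro divide_strict_right_mono) auto
    also have "\<dots> = (2 * Re u / N)\<^sup>2" by (simp add: power_divide power_mult_distrib)
    finally have "1 / N < (2 * Re u / N)\<^sup>2" .
    then have bc: "0 < b" "0 \<le> c" "c < b\<^sup>2"
      using Re N by (auto simp: b_def c_def divide_simps)
    define h where "h = [:1, b, c:]"
    have h_root: "poly (map_poly complex_of_real h) u = 0"
    proof -
      have "poly (map_poly complex_of_real h) u = 1 + u * (of_real b + u * of_real c)"
        by (simp add: h_def map_poly_pCons)
      also have "\<dots> = 0"
      proof (cases "Im u = 0")
        case True
        then show ?thesis using Re by (simp add: b_def c_def complex_eq_iff)
      next
        case False
        \<comment> \<open>The second factor is the conjugate of \<open>u\<close>.\<close>
        have "u * (2 * of_real (Re u) - u) = of_real N"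
          using N(1) by (simp add: complex_eq_iff power2_eq_square)
        moreover have "1 + u * (of_real b + u * of_real c) =
            1 - u * (2 * of_real (Re u) - u) / of_real N"
          using False by (simp add: b_def c_def diff_divide_distrib right_diff_distrib distrib_left)
        ultimately show ?thesis using N(2) by simp
      qed
      finally show ?thesis .
    qed
    \<comment> \<open>To see that \<open>h\<close> divides \<open>p\<close> over the reals, note
      that the remainder \<open>[:r, s:]\<close> vanishes at \<open>u\<close>. The imaginary part
      gives \<open>s = 0\<close> if \<open>u\<close> is not real, the degree bound if it is; then
      \<open>r = 0\<close> follows.\<close>
    have "map_poly complex_of_real p = map_poly of_real h * map_poly of_real (p div h) +
        map_poly of_real (p mod h)"
      by (metis map_poly_of_real_add map_poly_of_real_mult mult_div_mod_eq)
    then have root: "poly (map_poly complex_of_real (p mod h)) u = 0" using u h_root by simp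
    have deg: "degree (p mod h) < (if Im u = 0 then 1 else 2)"
      using degree_mod_less[of h p] bc N by (auto simp: h_def c_def)
    define r s where "r = coeff (p mod h) 0" and "s = coeff (p mod h) 1"
    have rs: "p mod h = [:r, s:]"
      using deg by (intro poly_eqI)
        (auto simp: r_def s_def coeff_pCons coeff_eq_0 split: nat.splits if_splits)
    with root have "of_real r + u * of_real s = 0" by (simp add: map_poly_pCons)
    moreover have "s = 0" if "Im u = 0" using that deg by (simp add: s_def coeff_eq_0)
    ultimately have "s = 0" "r = 0" by (auto simp: complex_eq_iff)
    then have "h dvd p" using rs by (simp add: mod_eq_0_iff_dvd)
    then obtain q where p: "p = [:1, b, c:] * q" by (auto simp: h_def elim: dvdE)
    have "q \<noteq> 0" using p less.prems(1) by auto
    then have "degree p = degree [:1, b, c:] + degree q"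
      unfolding p by (intro degree_mult_eq) auto
    then have "degree q < degree p" using bc by simp
    moreover have "0 < coeff q 0" using less.prems(1) by (simp add: p mult_poly_0)
    moreover have "\<bar>Im v\<bar> < - sqrt 3 * Re v" if "poly (map_poly of_real q) v = 0" for v
      using that by (intro less.prems(2)) (simp add: p map_poly_of_real_mult del: mult_pCons_left)
    ultimately have "positive_coeffs q \<and> strictly_log_concave q" by (intro less.hyps) auto
    then show ?thesis using strictly_log_concave_mult_quadratic bc p by blast
  qed
qed

section \<open>Independence polynomials and their behaviour under leafy extension\<close>

lemma finite_independent_sets: "finite (pverts G) \<Longrightarrow> finite (independent_sets G)"
  by (rule finite_subset[of _ "Pow (pverts G)"]) (auto simp: independent_sets_def)

lemma coeff_independence_poly:
  assumes "finite (pverts G)"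
  shows "coeff (independence_poly G) j = card {S \<in> independent_sets G. card S = j}"
proof -
  have "{S \<in> independent_sets G. card S = j} = {}" if "\<not> j \<le> independence_number G"
    using that finite_independent_sets[OF assms] unfolding independence_number_def
    by (auto intro: Max_ge)
  then have "\<not> j \<le> independence_number G \<Longrightarrow> card {S \<in> independent_sets G. card S = j} = 0"
    by (metis card.empty)
  then show ?thesis by (auto simp: independence_poly_def coeff_sum)
qed

text \<open>Grouping by size turns coefficients into a weighted sum over the sets themselves, so
  that bijections between set families become polynomial identities.\<close>

lemma poly_independence_poly:
  fixes x :: "'b :: comm_semiring_1"
  assumes "finite (pverts G)"
  shows "poly (map_poly of_nat (independence_poly G)) x = (\<Sum>S\<in>independent_sets G. x ^ card S)"
proof -
  note fin = finite_independent_sets[OF assms]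
  let ?n = "independence_number G"
  have le: "card ` independent_sets G \<subseteq> {..?n}"
    using fin by (auto simp: independence_number_def intro: Max_ge)
  have "map_poly of_nat (independence_poly G) =
      (\<Sum>j\<le>?n. monom (of_nat (card {S \<in> independent_sets G. card S = j}) :: 'b) j)"
    by (rule poly_eqI) (simp add: independence_poly_def coeff_map_poly coeff_sum)
  then have "poly (map_poly of_nat (independence_poly G)) x =
      (\<Sum>j\<le>?n. of_nat (card {S \<in> independent_sets G. card S = j}) * x ^ j)"
    by (simp add: poly_sum poly_monom)
  also have "\<dots> = (\<Sum>j\<le>?n. \<Sum>S | S \<in> independent_sets G \<and> card S = j. x ^ card S)"
    by simp
  also have "\<dots> = (\<Sum>S\<in>independent_sets G. x ^ card S)"
    using fin le by (intro sum.group) auto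
  finally show ?thesis .
qed

lemma coeff_independence_poly_0:
  assumes "finite (pverts G)"
  shows "coeff (independence_poly G) 0 = 1"
proof -
  have "{S \<in> independent_sets G. card S = 0} = {{}}"
    using assms by (auto simp: independent_sets_def dest: finite_subset)
  then show ?thesis by (simp add: coeff_independence_poly[OF assms])
qed

lemma poly_independence_poly_untagged:
  fixes x :: "'b :: comm_semiring_1"
  assumes "finite (pverts G)"
  shows "poly (map_poly of_nat (independence_poly (untagged G))) x =
    poly (map_poly of_nat (independence_poly G)) x"
proof -
  let ?t = "(`) (\<lambda>v. (v, [] :: bool list))"
  have inj: "inj_on ?t A" for A :: "'a set set"
    by (rule inj_onI) (auto simp: inj_image_eq_iff inj_on_def)
  have "independent_sets (untagged G) = ?t ` independent_sets G"
  proof (intro equalityI subsetI)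
    fix S assume "S \<in> independent_sets (untagged G)"
    then have S: "S \<subseteq> (\<lambda>v. (v, [])) ` pverts G"
        "\<And>u v. u \<in> S \<Longrightarrow> v \<in> S \<Longrightarrow> (u, v) \<notin> parcs (untagged G)"
      by (auto simp: independent_sets_def untagged_def)
    from S(1) obtain A where A: "A \<subseteq> pverts G" "S = ?t A" by (auto elim: subset_imageE)
    have "(u, v) \<notin> parcs G" if "u \<in> A" "v \<in> A" for u v
      using S(2)[of "(u, [])" "(v, [])"] that A(2) by (force simp: untagged_def)
    with A show "S \<in> ?t ` independent_sets G" by (auto simp: independent_sets_def)
  qed (auto simp: independent_sets_def untagged_def)
  moreover have "card (?t S) = card S" for S :: "'a set"
    by (rule card_image) (simp add: inj_on_def)
  moreover have "finite (pverts (untagged G))" using assms by (simp add: untagged_def)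
  ultimately show ?thesis
    using assms by (simp add: poly_independence_poly sum.reindex[OF inj])
qed

text \<open>Leaves are pairwise non-adjacent and each sees only its own old vertex. Once the old
  part \<open>S\<close> is fixed, the leaves over vertices outside \<open>S\<close> can therefore be
  chosen freely.\<close>

lemma independent_sets_leafy_extension:
  "independent_sets (leafy_extension G) =
    (\<lambda>(S, T). old_vertex ` S \<union> new_leaf ` T) `
      (SIGMA S:independent_sets G. Pow (pverts G - S))"
  (is "?I = ?f ` ?J")
proof (intro equalityI subsetI)
  fix U assume U: "U \<in> ?I"
  define S T where "S = old_vertex -` U" and "T = new_leaf -` U"
  have sub: "U \<subseteq> old_vertex ` pverts G \<union> new_leaf ` pverts G"
    and arcs: "\<And>u v. u \<in> U \<Longrightarrow> v \<in> U \<Longrightarrow> (u, v) \<notin> parcs (leafy_extension G)"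
    using U by (auto simp: independent_sets_def leafy_extension_def)
  have "U = ?f (S, T)"
    using sub by (auto simp: S_def T_def simp del: split_paired_All split_paired_Ex)
  moreover have "S \<in> independent_sets G"
    unfolding independent_sets_def
  proof (intro CollectI conjI ballI notI)
    show "S \<subseteq> pverts G"
      using sub by (auto simp: S_def simp del: split_paired_All split_paired_Ex)
    fix u v assume "u \<in> S" "v \<in> S" "(u, v) \<in> parcs G"
    with arcs[of "old_vertex u" "old_vertex v"] show False
      by (force simp: S_def leafy_extension_def)
  qed
  moreover have "T \<subseteq> pverts G - S"
  proof
    fix v assume "v \<in> T"
    with sub have v: "v \<in> pverts G"
      by (auto simp: T_def simp del: split_paired_All split_paired_Ex)
    with \<open>v \<in> T\<close> arcs[of "old_vertex v" "new_leaf v"] show "v \<in> pverts G - S"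
      by (auto simp: S_def T_def leafy_extension_def)
  qed
  ultimately show "U \<in> ?f ` ?J" by blast
next
  fix U assume "U \<in> ?f ` ?J"
  then obtain S T where "S \<in> independent_sets G" "T \<subseteq> pverts G - S"
      "U = old_vertex ` S \<union> new_leaf ` T"
    by auto
  then show "U \<in> ?I"
    unfolding independent_sets_def leafy_extension_def pair_pre_digraph.simps
    by (auto simp del: split_paired_All split_paired_Ex)
qed

text \<open>For fixed \<open>S\<close>, the free choice of leaves contributes
  \<open>(1 + x) ^ (card (pverts G) - card S)\<close>; pulling out the full power of
  \<open>1 + x\<close> leaves \<open>(x / (1 + x)) ^ card S\<close>.\<close>

lemma poly_independence_poly_leafy_extension:
  fixes x :: "'b :: field"
  assumes "finite (pverts G)" and "1 + x \<noteq> 0"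
  shows "poly (map_poly of_nat (independence_poly (leafy_extension G))) x =
    (1 + x) ^ card (pverts G) * poly (map_poly of_nat (independence_poly G)) (x / (1 + x))"
proof -
  let ?V = "pverts G"
  let ?f = "\<lambda>(S, T). old_vertex ` S \<union> new_leaf ` T"
  let ?J = "SIGMA S:independent_sets G. Pow (?V - S)"
  have fin_subset: "finite S" if "S \<subseteq> ?V" for S
    using that assms(1) finite_subset by blast
  have "finite (pverts (leafy_extension G))"
    using assms(1) by (simp add: leafy_extension_def)
  then have "poly (map_poly of_nat (independence_poly (leafy_extension G))) x =
      (\<Sum>U\<in>?f ` ?J. x ^ card U)"
    by (simp add: poly_independence_poly independent_sets_leafy_extension)
  also have "\<dots> = (\<Sum>p\<in>?J. x ^ card (?f p))"
  proof (rule sum.reindex_cong[of ?f])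
    \<comment> \<open>The two preimages recover \<open>S\<close> and \<open>T\<close> from the
      union, which gives injectivity.\<close>
    have "old_vertex -` ?f (S, T) = S" "new_leaf -` ?f (S, T) = T" for S T
      by (auto simp del: split_paired_All split_paired_Ex)
    then show "inj_on ?f ?J" unfolding inj_on_def by (metis surj_pair)
  qed auto
  also have "\<dots> = (\<Sum>(S, T)\<in>?J. x ^ card S * x ^ card T)"
  proof (rule sum.cong[OF refl], clarsimp)
    fix S T assume ST: "S \<in> independent_sets G" "T \<subseteq> ?V - S"
    then have "finite S" "finite T" by (auto simp: independent_sets_def intro: fin_subset)
    then have "card (old_vertex ` S \<union> new_leaf ` T) = card S + card T"
      by (subst card_Un_disjoint)
        (auto simp: card_image inj_on_def simp del: split_paired_All split_paired_Ex)
    then show "x ^ card (old_vertex ` S \<union> new_leaf ` T) = x ^ card S * x ^ card T"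
      by (simp add: power_add)
  qed
  also have "\<dots> = (\<Sum>S\<in>independent_sets G. \<Sum>T\<in>Pow (?V - S). x ^ card S * x ^ card T)"
    using assms(1) by (intro sum.Sigma[symmetric]) (auto simp: finite_independent_sets)
  also have "\<dots> = (\<Sum>S\<in>independent_sets G. (1 + x) ^ card ?V * (x / (1 + x)) ^ card S)"
  proof (rule sum.cong[OF refl])
    fix S assume S: "S \<in> independent_sets G"
    then have "S \<subseteq> ?V" by (simp add: independent_sets_def)
    then have card: "card ?V = card (?V - S) + card S"
      using assms(1) by (simp add: card_Diff_subset card_mono fin_subset)
    \<comment> \<open>The binomial theorem in subset form: expand a product of
      \<open>card (?V - S)\<close> equal factors \<open>x + 1\<close>.\<close>
    have "(\<Sum>T\<in>Pow (?V - S). x ^ card T) = (1 + x) ^ card (?V - S)"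
      using prod_add[of "?V - S" "\<lambda>_. x" "\<lambda>_. 1"] assms(1) by (simp add: add.commute)
    then show "(\<Sum>T\<in>Pow (?V - S). x ^ card S * x ^ card T) =
        (1 + x) ^ card ?V * (x / (1 + x)) ^ card S"
      using assms(2) by (simp add: card power_add power_divide flip: sum_distrib_left)
  qed
  also have "\<dots> = (1 + x) ^ card ?V * poly (map_poly of_nat (independence_poly G)) (x / (1 + x))"
    by (simp add: poly_independence_poly assms(1) sum_distrib_left)
  finally show ?thesis .
qed

section \<open>Roots of the iterated extensions and the sector condition\<close>

text \<open>In the coordinate \<open>inverse x\<close>, the substitution \<open>x / (1 + x)\<close>
  is translation by \<open>1\<close>. The exceptional root \<open>-1\<close> starts a chain of
  negative reals, since subtracting \<open>1\<close> from a negative reciprocal keeps it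
  negative.\<close>

lemma root_iterated_leafy_extension:
  fixes x :: complex
  assumes "pair_graph G"
    and "poly (map_poly of_nat (independence_poly (iterated_leafy_extension k G))) x = 0"
  shows "Im x = 0 \<and> Re x < 0 \<or>
    (\<exists>z. poly (map_poly of_nat (independence_poly G)) z = 0 \<and> inverse x = inverse z - of_nat k)"
  using assms(2)
proof (induction k arbitrary: x)
  case 0
  then show ?case
    by (auto simp: iterated_leafy_extension_def
        poly_independence_poly_untagged[OF pair_graphD(1)[OF assms(1)]])
next
  case (Suc k)
  let ?H = "iterated_leafy_extension k G"
  have fin: "finite (pverts ?H)"
    using assms(1) pair_graph_iterated_leafy_extension pair_graphD(1) by blast
  have H: "iterated_leafy_extension (Suc k) G = leafy_extension ?H"
    by (simp add: iterated_leafy_extension_def)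
  \<comment> \<open>The constant term is \<open>1\<close>, so reciprocals of roots are
    meaningful.\<close>
  have x0: "x \<noteq> 0"
  proof
    assume "x = 0"
    with Suc.prems show False
      using assms(1) by (simp add: poly_0_coeff_0 coeff_map_poly coeff_independence_poly_0
          pair_graphD(1) pair_graph_iterated_leafy_extension)
  qed
  show ?case
  proof (cases "1 + x = 0")
    case True
    then have "x = - 1" by (simp add: add_eq_0_iff)
    then show ?thesis by simp
  next
    case False
    define y where "y = x / (1 + x)"
    have inv: "inverse x = inverse y - 1" using x0 False by (simp add: y_def field_simps)
    have "poly (map_poly of_nat (independence_poly ?H)) y = 0"
      using Suc.prems False fin by (simp add: H poly_independence_poly_leafy_extension y_def)
    from Suc.IH[OF this] show ?thesis
    proof
      assume y: "Im y = 0 \<and> Re y < 0"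
      then have "y = of_real (Re y)" by (simp add: complex_eq_iff)
      then have "inverse x = of_real (inverse (Re y) - 1)"
        using inv by (metis of_real_1 of_real_diff of_real_inverse)
      then have "x = of_real (inverse (inverse (Re y) - 1))"
        by (metis inverse_inverse_eq of_real_inverse)
      moreover have "inverse (Re y) < 0" using y by simp
      then have "inverse (Re y) - 1 < 0" by linarith
      then have "inverse (inverse (Re y) - 1) < 0" by (rule negative_imp_inverse_negative)
      ultimately show ?thesis by (metis Im_complex_of_real Re_complex_of_real)
    next
      assume "\<exists>z. poly (map_poly of_nat (independence_poly G)) z = 0 \<and>
        inverse y = inverse z - of_nat k"
      moreover have "inverse x = inverse z - of_nat (Suc k)"
        if "inverse y = inverse z - of_nat k" for z
        using that inv by simp
      ultimately show ?thesis by blast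
    qed
  qed
qed

theorem theorem2p4:
  fixes G :: "'a pair_pre_digraph" and k :: nat
  assumes "pair_graph G" and "pverts G \<noteq> {}"
    and "k \<ge> 1"
    and "real k > Max {(1 / sqrt 3 * \<bar>Im z\<bar> + \<bar>Re z\<bar>) / (cmod z)\<^sup>2 | z :: complex.
                          poly (map_poly of_nat (independence_poly G)) z = 0}"
  shows "strictly_log_concave (independence_poly (iterated_leafy_extension k G))"
proof -
  let ?H = "iterated_leafy_extension k G"
  let ?i = "map_poly of_nat (independence_poly G) :: complex poly"
  let ?m = "\<lambda>z. (1 / sqrt 3 * \<bar>Im z\<bar> + \<bar>Re z\<bar>) / (cmod z)\<^sup>2"
  have fin: "finite (pverts G)" "finite (pverts ?H)"
    using assms(1) pair_graph_iterated_leafy_extension pair_graphD(1) by blast+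
  have i0: "coeff ?i 0 = 1" using coeff_independence_poly_0[OF fin(1)] by (simp add: coeff_map_poly)
  then have "?i \<noteq> 0" by auto
  \<comment> \<open>A nonzero polynomial has finitely many roots, so \<open>Max\<close> is a genuine
    upper bound.\<close>
  then have fin_m: "finite (?m ` {z. poly ?i z = 0})" by (intro finite_imageI poly_roots_finite)
  have Max_less: "Max (?m ` {z. poly ?i z = 0}) < real k"
    using assms(4) unfolding setcompr_eq_image .
  have k: "?m z < real k" if "poly ?i z = 0" for z
  proof -
    have "?m z \<le> Max (?m ` {z. poly ?i z = 0})"
      using fin_m that by (intro Max_ge imageI) simp_all
    also have "\<dots> < real k" by (rule Max_less)
    finally show ?thesis .
  qed
  \<comment> \<open>The real copy of the polynomial allows factoring; degree and coefficient
    inequalities transfer back to the naturals at the end.\<close>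
  define p where "p = map_poly real (independence_poly ?H)"
  have p_complex: "map_poly complex_of_real p = map_poly of_nat (independence_poly ?H)"
    by (rule poly_eqI) (simp add: p_def coeff_map_poly)
  have "\<bar>Im u\<bar> < - sqrt 3 * Re u" if "poly (map_poly of_real p) u = 0" for u
  proof -
    have "poly (map_poly of_nat (independence_poly ?H)) u = 0" using that p_complex by simp
    from root_iterated_leafy_extension[OF assms(1) this] show ?thesis
    proof
      assume "Im u = 0 \<and> Re u < 0"
      then show ?thesis by (simp add: mult_pos_neg)
    next
      assume "\<exists>z. poly ?i z = 0 \<and> inverse u = inverse z - of_nat k"
      then obtain z where z: "poly ?i z = 0" "inverse u = inverse z - of_nat k" by blast
      have "z \<noteq> 0" using z(1) i0 by (auto simp: poly_0_coeff_0)
      then have Nz: "0 < (cmod z)\<^sup>2" by simp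
      define N where "N = (cmod u)\<^sup>2"
      \<comment> \<open>Real and imaginary parts of \<open>inverse u = cnj u / N\<close>: the shift
        by \<open>k\<close> affects only the real part.\<close>
      have Im_u: "Im u / N = Im z / (cmod z)\<^sup>2" and Re_u: "Re u / N = Re z / (cmod z)\<^sup>2 - real k"
        using z(2) unfolding complex_eq_iff N_def by (simp_all add: cmod_power2)
      have "\<bar>Im u\<bar> / N = \<bar>Im z\<bar> / (cmod z)\<^sup>2"
        using arg_cong[OF Im_u, of abs] by (simp add: N_def)
      also have "\<dots> < sqrt 3 * (real k - Re z / (cmod z)\<^sup>2)"
      proof -
        \<comment> \<open>Replacing \<open>Re z\<close> by its absolute value gives the quantity
          bounded by the maximum; multiplied by \<open>sqrt 3\<close>, the bound is the sector
          condition for \<open>u\<close> divided by \<open>N\<close>.\<close>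
        have "(1 / sqrt 3 * \<bar>Im z\<bar> + Re z) / (cmod z)\<^sup>2 \<le> ?m z"
          using Nz by (intro divide_right_mono) auto
        also have "\<dots> < real k" using k z(1) by blast
        finally have "1 / sqrt 3 * \<bar>Im z\<bar> / (cmod z)\<^sup>2 < real k - Re z / (cmod z)\<^sup>2"
          by (simp add: add_divide_distrib)
        then have "sqrt 3 * (1 / sqrt 3 * \<bar>Im z\<bar> / (cmod z)\<^sup>2) <
            sqrt 3 * (real k - Re z / (cmod z)\<^sup>2)"
          by (intro mult_strict_left_mono) auto
        then show ?thesis by simp
      qed
      also have "real k - Re z / (cmod z)\<^sup>2 = - (Re u / N)" using Re_u by simp
      finally have less: "\<bar>Im u\<bar> / N < - sqrt 3 * Re u / N" by simp
      \<comment> \<open>Division by zero yields \<open>0\<close>, so \<open>N = 0\<close> would turn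
        the strict inequality into \<open>0 < 0\<close>.\<close>
      then have "N \<noteq> 0" by auto
      then have "0 < N" by (simp add: N_def)
      with less show ?thesis by (metis divide_less_cancel less_asym)
    qed
  qed
  moreover have "0 < coeff p 0"
    using coeff_independence_poly_0[OF fin(2)] by (simp add: p_def coeff_map_poly)
  ultimately have "strictly_log_concave p"
    using strictly_log_concave_if_roots_in_sector by blast
  moreover have "degree p = degree (independence_poly ?H)"
    unfolding p_def by (rule degree_map_poly) simp
  ultimately show ?thesis
    by (simp add: strictly_log_concave_def p_def coeff_map_poly flip: of_nat_mult of_nat_power)
qed

end
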